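(* Let $D$ be a finite tensor shape of explainable dimensions, let $L\ge1$, and let $C_0,C_1,\dots,C_L$ be finite channel shapes with $C_L=c$, the number of outputs. Let $f^{(l)}:\mathbb{R}^{D\times C_{l-1}}\to\mathbb{R}^{C_l}$, $l=1,\dots,L$, be arbitrary functions, and let $\Omega^{(l)}:\mathbb{R}^{D\times C_{l-1}}\to\mathbb{R}^{D\times C_l}$ be the Shapley transform with underlying function $f^{(l)}$, where $\Omega^{(1)}$ uses an arbitrary reference tensor $r\in\mathbb{R}^{D\times C_0}$ and $\Omega^{(2)},\dots,\Omega^{(L)}$ use the zero reference tensor. Let $$h=\Omega^{(L)}\circ\Omega^{(L-1)}\circ\cdots\circ\Omega^{(1)}:\mathbb{R}^{D\times C_0}\to\mathbb{R}^{D\times c}$$ be the Deep ShapNet explanation and let $\mathcal{H}(x)=\sum_{i\in\mathcal{I}_D}h_i(x)\in\mathbb{R}^{c}$ be the Deep ShapNet. Then, for every $x\in\mathbb{R}^{D\times C_0}$, the explanation $h(x)$ satisfies both local accuracy and missingness with respect to $\mathcal{H}$; that is: (local accuracy) the attributions $h_i(x)\in\mathbb{R}^c$, $i\in\mathcal{I}_D$ (with constant term $a_0=0$), sum to the output of the model: $\mathcal{H}(x)=\sum_{i\in\mathcal{I}_D}h_i(x)$; (missingness) for every $i\in\mathcal{I}_D$, if feature $i$ is missing from the input, i.e. $x_i=r_i$, then $h_i(x)=0$.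
   Context: $\mathcal{I}_D$ denotes the finite set of all indices of the dimensions $D$; put $d=|\mathcal{I}_D|\ge1$. A tensor $x\in\mathbb{R}^{D\times C}$ has, for each $i\in\mathcal{I}_D$, a component $x_i\in\mathbb{R}^C$ (all channels of a given explainable index are treated as one group). SHAP values with reference $r\in\mathbb{R}^{D\times C}$: for $z\in\{0,1\}^{\mathcal{I}_D}$ let $\Psi_{x,r}(z)\in\mathbb{R}^{D\times C}$ be the tensor whose $i$-th component is $x_i$ if $z_i=1$ ("present") and $r_i$ if $z_i=0$ ("absent"). For a scalar function $f:\mathbb{R}^{D\times C}\to\mathbb{R}$ and $i\in\mathcal{I}_D$, $$\phi_i(f,x)=\frac1d\sum_{z\in\{0,1\}^{\mathcal{I}_D},\,z_i=0}\binom{d-1}{\|z\|_1}^{-1}\Big[f\big(\Psi_{x,r}(z\cup\{i\})\big)-f\big(\Psi_{x,r}(z)\big)\Big],$$ where $\|z\|_1=\sum_i z_i$ and $z\cup\{i\}$ is $z$ with its $i$-th entry changed from $0$ to $1$. Shapley transform with underlying function $f:\mathbb{R}^{D\times C}\to\mathbb{R}^{C'}$ (scalar outputs $f_j$) and reference $r$: $[\Omega(x)]_{i,j}=[\Omega(x,f)]_{i,j}=\phi_i(f_j,x)$ for $i\in\mathcal{I}_D$, $j\in\mathcal{I}_{C'}$, where $\mathcal{I}_{C'}$ is the index set of $C'$. Properties of an additive attribution $(a_0,(a_i)_i)$ of a model output $F(x)$: local accuracy means $F(x)=a_0+\sum_i a_i$; missingness means that $a_i=0$ whenever feature $i$ is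 missing, i.e. takes its reference value $x_i=r_i$. For vector-valued outputs the properties are read componentwise. *)

theory Defs
  imports Complex_Main "HOL-Library.FuncSet"
begin

text \<open>
  Shapes are lists of side lengths and their indices are multi-indices, so the shape may vary with
  the layer. A tensor is a real function on indices, taken extensional (\<open>undefined\<close> outside the
  index set) so that equality of tensors is equality of their entries.
\<close>

type_synonym vec = "nat list \<Rightarrow> real"
type_synonym tensor = "nat list \<Rightarrow> vec"

definition indices :: "nat list \<Rightarrow> nat list set" where
  "indices S = {k. list_all2 (<) k S}"

lemma finite_indices: "finite (indices S)"
proof (induction S)
  case Nil
  show ?case by (simp add: indices_def)
next
  case (Cons n S)
  have "indices (n # S) = (\<lambda>(a, k). a # k) ` ({..<n} \<times> indices S)"
    by (auto simp: indices_def list_all2_Cons2 image_iff)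
  with Cons.IH show ?case by simp
qed

definition vectors :: "nat list \<Rightarrow> vec set" where
  "vectors C = indices C \<rightarrow>\<^sub>E UNIV"

text \<open>The tensors of shape \<open>D \<times> C\<close>, grouped by explainable index: \<open>x i\<close> is the component
  in \<open>vectors C\<close>.\<close>

definition tensors :: "nat list \<Rightarrow> nat list \<Rightarrow> tensor set" where
  "tensors D C = indices D \<rightarrow>\<^sub>E vectors C"

definition zero_vec :: "nat list \<Rightarrow> vec" where
  "zero_vec C = (\<lambda>j\<in>indices C. 0)"

definition zero_tensor :: "nat list \<Rightarrow> nat list \<Rightarrow> tensor" where
  "zero_tensor D C = (\<lambda>i\<in>indices D. zero_vec C)"

definition mix :: "nat list \<Rightarrow> tensor \<Rightarrow> tensor \<Rightarrow> (nat list \<Rightarrow> nat) \<Rightarrow> tensor" where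
  "mix D x r z = (\<lambda>i\<in>indices D. if z i = 1 then x i else r i)"

definition shap_value ::
  "nat list \<Rightarrow> tensor \<Rightarrow> (tensor \<Rightarrow> real) \<Rightarrow> tensor \<Rightarrow> nat list \<Rightarrow> real" where
  "shap_value D r f x i =
     1 / real (card (indices D)) *
     (\<Sum>z | z \<in> indices D \<rightarrow>\<^sub>E {0, 1} \<and> z i = 0.
        inverse (real ((card (indices D) - 1) choose (\<Sum>k\<in>indices D. z k))) *
        (f (mix D x r (z(i := 1))) - f (mix D x r z)))"

definition shapley_transform ::
  "nat list \<Rightarrow> nat list \<Rightarrow> tensor \<Rightarrow> (tensor \<Rightarrow> vec) \<Rightarrow> tensor \<Rightarrow> tensor" where
  "shapley_transform D C' r f x =
     (\<lambda>i\<in>indices D. \<lambda>j\<in>indices C'. shap_value D r (\<lambda>y. f y j) x i)"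

text \<open>\<open>deep_explanation D C f r l\<close> is the composite of the first \<open>l\<close> Shapley transforms; layer
  \<open>l\<close> maps channel shape \<open>C (l - 1)\<close> to \<open>C l\<close>, and only layer 1 uses the reference \<open>r\<close>.\<close>

primrec deep_explanation ::
  "nat list \<Rightarrow> (nat \<Rightarrow> nat list) \<Rightarrow> (nat \<Rightarrow> tensor \<Rightarrow> vec) \<Rightarrow> tensor \<Rightarrow> nat \<Rightarrow> tensor \<Rightarrow> tensor" where
  "deep_explanation D C f r 0 = id"
| "deep_explanation D C f r (Suc l) =
     shapley_transform D (C (Suc l)) (if l = 0 then r else zero_tensor D (C l)) (f (Suc l))
     \<circ> deep_explanation D C f r l"

definition deep_shapnet ::
  "nat list \<Rightarrow> (nat \<Rightarrow> nat list) \<Rightarrow> (nat \<Rightarrow> tensor \<Rightarrow> vec) \<Rightarrow> tensor \<Rightarrow> nat \<Rightarrow> tensor \<Rightarrow> vec" where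
  "deep_shapnet D C f r L x =
     (\<lambda>j\<in>indices (C L). \<Sum>i\<in>indices D. deep_explanation D C f r L x i j)"

text \<open>Properties of an attribution with constant term \<open>a0\<close> and feature attributions \<open>a i\<close>, for a
  model \<open>F\<close> with output shape \<open>C\<close> at the input \<open>x\<close>.\<close>

definition local_accuracy ::
  "nat list \<Rightarrow> nat list \<Rightarrow> (tensor \<Rightarrow> vec) \<Rightarrow> tensor \<Rightarrow> vec \<Rightarrow> tensor \<Rightarrow> bool" where
  "local_accuracy D C F x a0 a \<longleftrightarrow>
     (\<forall>j\<in>indices C. F x j = a0 j + (\<Sum>i\<in>indices D. a i j))"

definition missingness ::
  "nat list \<Rightarrow> nat list \<Rightarrow> tensor \<Rightarrow> tensor \<Rightarrow> tensor \<Rightarrow> bool" where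
  "missingness D C r x a \<longleftrightarrow> (\<forall>i\<in>indices D. x i = r i \<longrightarrow> a i = zero_vec C)"

end

theory Submission
  imports Defs
begin

text \<open>Local accuracy is built into the model, which sums the attributions. For missingness, if
  x_i = r_i then switching i on does not change the masked input, so every marginal contribution of
  i vanishes, whatever the underlying function (\<open>shap_value_missing\<close>). Layer 1 thus
  sends feature i to zero, and the zero references of the later layers let the argument repeat
  (\<open>deep_explanation_missing\<close>).\<close>

lemma mix_missing: "x i = r i \<Longrightarrow> mix D x r (z(i := 1)) = mix D x r z"
  by (auto simp: mix_def restrict_def)

lemma shap_value_missing: "x i = r i \<Longrightarrow> shap_value D r f x i = 0"
  \<comment> \<open>Rewriting \<open>1\<close> to \<open>Suc 0\<close> would keep
    \<open>mix_missing\<close> from matching.\<close>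
  by (simp add: shap_value_def mix_missing del: One_nat_def)

lemma shapley_transform_missing:
  assumes "i \<in> indices D" "x i = r i"
  shows "shapley_transform D C' r f x i = zero_vec C'"
  using assms by (simp add: shapley_transform_def shap_value_missing zero_vec_def)

text \<open>A missing feature leaves layer 1 with component zero, which is its value in the reference
  of the next layer, so it stays missing throughout.\<close>

lemma deep_explanation_missing:
  assumes i: "i \<in> indices D" and missing: "x i = r i"
  shows "deep_explanation D C f r (Suc l) x i = zero_vec (C (Suc l))"
proof (induction l)
  case 0
  \<comment> \<open>Layer 1 acts on \<open>x\<close> itself with reference \<open>r\<close>, so the
    assumption on \<open>x i\<close> applies directly.\<close>
  show ?case using assms by (simp add: shapley_transform_missing)
next
  case (Suc l)
  have "deep_explanation D C f r (Suc l) x i = zero_tensor D (C (Suc l)) i"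
    unfolding Suc.IH using i by (simp add: zero_tensor_def)
  then have "shapley_transform D (C (Suc (Suc l))) (zero_tensor D (C (Suc l))) (f (Suc (Suc l)))
      (deep_explanation D C f r (Suc l) x) i = zero_vec (C (Suc (Suc l)))"
    by (rule shapley_transform_missing[OF i])
  then show ?case by simp
qed

theorem theorem3:
  fixes D :: "nat list" and C :: "nat \<Rightarrow> nat list" and L c :: nat
    and f :: "nat \<Rightarrow> tensor \<Rightarrow> vec" and r x :: tensor
  assumes "card (indices D) \<ge> 1"
    and "L \<ge> 1"
    and "C L = [c]"
    and "\<And>l. l \<in> {1..L} \<Longrightarrow> f l \<in> tensors D (C (l - 1)) \<rightarrow> vectors (C l)"
    and "r \<in> tensors D (C 0)"
    and "x \<in> tensors D (C 0)"
  shows "local_accuracy D [c] (deep_shapnet D C f r L) x (zero_vec [c]) (deep_explanation D C f r L x)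
       \<and> missingness D [c] r x (deep_explanation D C f r L x)"
proof
  show "local_accuracy D [c] (deep_shapnet D C f r L) x (zero_vec [c]) (deep_explanation D C f r L x)"
    using assms(3) by (simp add: local_accuracy_def deep_shapnet_def zero_vec_def)
  \<comment> \<open>At least one layer is essential: with none, the explanation is \<open>x\<close>,
    whose missing components equal those of \<open>r\<close> rather than zero.\<close>
  obtain l where "L = Suc l"
    using assms(2) by (cases L) auto
  then show "missingness D [c] r x (deep_explanation D C f r L x)"
    unfolding missingness_def
    using deep_explanation_missing[of _ D x r C f l] assms(3)
    \<comment> \<open>The recursion stays folded so that the lemma matches at
      \<open>Suc l\<close>.\<close>
    by (simp del: deep_explanation.simps)
qed

end
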